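(* Let $g:\mathbb{R}^d\to\mathbb{R}^n$ and let $\mathcal{Z}=\operatorname{cl}\{g(\theta):\theta\in\mathbb{R}^d\}$. Assume that $\mathcal{Z}$ is convex, that $F:\mathcal{Z}\to\mathbb{R}^n$ is $L$-Lipschitz ($\|F(x)-F(y)\|\le L\|x-y\|$ for all $x,y\in\mathcal{Z}$) and $\mu$-strongly monotone for some $\mu>0$ ($\langle F(x)-F(y),x-y\rangle\ge\mu\|x-y\|^2$ for all $x,y\in\mathcal{Z}$), and that there is a solution $z_\ast\in\operatorname{ri}\mathcal{Z}$ of the variational inequality $$\langle F(z_\ast),z-z_\ast\rangle\ge 0\quad\text{for all } z\in\mathcal{Z}.$$ Let $\{z_t=g(\theta_t)\}_{t\in\mathbb{N}}$ (with $t\geq 1$) be the iterates produced by the "$\alpha$-descent on surrogate" algorithm with parameters $\alpha\in(0,1)$ and $\eta>0$. If $\alpha$ and $\eta$ are such that $$\rho:=1-2\eta(\mu-\alpha L)+(1+\alpha^2)\eta^2L^2<1,$$ then $z_t$ converges linearly to $z_\ast$ with $$\|z_{t+1}-z_\ast\|^2\le\rho^t\|z_1-z_\ast\|^2 .$$ In particular, if $\alpha<\frac{\mu}{L}$ and $\eta<\frac{2(\mu-\alpha L)}{(1+\alpha^2)L^2}$ then $\rho<1$; and if $\alpha\le\frac{\mu}{2L}$ and $\eta=\frac{2\mu}{5L^2}$ then $\rho\le 1-\frac{\mu^2}{5L^2}$.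
   Context: $\|\cdot\|$ and $\langle\cdot,\cdot\rangle$ are the Euclidean norm and inner product; $\operatorname{cl}$ and $\operatorname{ri}$ denote closure and relative interior. The "$\alpha$-descent on surrogate" algorithm. Inputs: initial $\theta_1\in\mathbb{R}^d$, step size $\eta>0$, $\alpha\in(0,1)$, and an arbitrary optimizer update rule $\mathcal{A}$ mapping a (loss, parameter) pair to a new parameter in $\mathbb{R}^d$. For each $t=1,2,\dots$: define the surrogate loss $\ell_t(\theta)=\frac12\|g(\theta)-(g(\theta_t)-\eta F(g(\theta_t)))\|^2$ and $\ell_t^\ast=\inf_{\theta\in\mathbb{R}^d}\ell_t(\theta)$; set $\theta_s\leftarrow\theta_t$; while $\ell_t(\theta_s)-\ell_t^\ast>\alpha^2(\ell_t(\theta_t)-\ell_t^\ast)$, update $\theta_s\leftarrow\mathcal{A}(\ell_t,\theta_s)$; when the while loop ends set $\theta_{t+1}\leftarrow\theta_s$. "The iterates produced" presupposes that each inner loop terminates, so that $\ell_t(\theta_{t+1})-\ell_t^\ast\le\alpha^2(\ell_t(\theta_t)-\ell_t^\ast)$ for every $t$.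
   Formalization: The last claim (ρ ≤ 1 − μ²/(5L²)) is stated only when Z is not the single point z_* or μ ≤ L; for constant g with μ > L it fails as printed (L=1, μ=2, α=0.9, η=0.8 gives ρ=0.3984 > 0.2). *)

theory Defs
  imports "HOL-Analysis.Analysis" "HOL-Library.While_Combinator"
begin

definition strongly_monotone_on :: "real \<Rightarrow> 'a::real_inner set \<Rightarrow> ('a \<Rightarrow> 'a) \<Rightarrow> bool" where
  "strongly_monotone_on \<mu> Z F \<longleftrightarrow>
     (\<forall>x\<in>Z. \<forall>y\<in>Z. (F x - F y) \<bullet> (x - y) \<ge> \<mu> * (norm (x - y))\<^sup>2)"

definition vi_solution :: "('a::real_inner \<Rightarrow> 'a) \<Rightarrow> 'a set \<Rightarrow> 'a \<Rightarrow> bool" where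
  "vi_solution F Z x \<longleftrightarrow> x \<in> Z \<and> (\<forall>z\<in>Z. F x \<bullet> (z - x) \<ge> 0)"

text \<open>The surrogate loss at the current outer iterate \<open>\<theta>t\<close>, as a function of \<open>\<theta>\<close>.\<close>

definition surrogate_loss ::
  "('p \<Rightarrow> 'a::real_inner) \<Rightarrow> ('a \<Rightarrow> 'a) \<Rightarrow> real \<Rightarrow> 'p \<Rightarrow> 'p \<Rightarrow> real" where
  "surrogate_loss g F \<eta> \<theta>t \<theta> = 1 / 2 * (norm (g \<theta> - (g \<theta>t - \<eta> *\<^sub>R F (g \<theta>t))))\<^sup>2"

text \<open>The inner loop of one outer iteration, started at \<open>\<theta>t\<close>. The result is \<open>None\<close> iff the
  loop does not terminate. The infimum is a genuine one, the loss being bounded below by 0.\<close>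

definition surrogate_descent_step ::
  "('p \<Rightarrow> 'a::real_inner) \<Rightarrow> ('a \<Rightarrow> 'a) \<Rightarrow> real \<Rightarrow> real \<Rightarrow> (('p \<Rightarrow> real) \<Rightarrow> 'p \<Rightarrow> 'p)
     \<Rightarrow> 'p \<Rightarrow> 'p option" where
  "surrogate_descent_step g F \<eta> \<alpha> \<A> \<theta>t =
     (let l = surrogate_loss g F \<eta> \<theta>t; l_inf = (INF \<theta>. l \<theta>)
      in while_option (\<lambda>\<theta>s. l \<theta>s - l_inf > \<alpha>\<^sup>2 * (l \<theta>t - l_inf)) (\<lambda>\<theta>s. \<A> l \<theta>s) \<theta>t)"

text \<open>\<open>\<theta> 1, \<theta> 2, \<dots>\<close> are the parameters produced by the algorithm from the initial parameter
  \<open>\<theta> 1\<close>, every inner loop terminating; \<open>\<theta> 0\<close> is irrelevant.\<close>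

definition surrogate_descent_iterates ::
  "('p \<Rightarrow> 'a::real_inner) \<Rightarrow> ('a \<Rightarrow> 'a) \<Rightarrow> real \<Rightarrow> real \<Rightarrow> (('p \<Rightarrow> real) \<Rightarrow> 'p \<Rightarrow> 'p)
     \<Rightarrow> (nat \<Rightarrow> 'p) \<Rightarrow> bool" where
  "surrogate_descent_iterates g F \<eta> \<alpha> \<A> \<theta> \<longleftrightarrow>
     (\<forall>t\<ge>1. surrogate_descent_step g F \<eta> \<alpha> \<A> (\<theta> t) = Some (\<theta> (t + 1)))"

end

theory Submission
  imports Defs
begin

text \<open>Since \<open>z_star\<close> lies in the relative interior of \<open>Z\<close>, the vector \<open>F z_star\<close> is orthogonal
  to \<open>Z - z_star\<close>. Hence replacing the target \<open>z - \<eta> F z\<close> of the surrogate by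
  \<open>w = z - \<eta> (F z - F z_star)\<close> changes the squared distances to points of \<open>Z\<close> by a constant only,
  and the descent condition is unaffected. Let \<open>p\<close> be the projection of \<open>w\<close> onto \<open>Z\<close>. The
  obtuse-angle property of projections and the descent condition give
  \<open>\<parallel>z' - p\<parallel> \<le> \<alpha> \<parallel>z - w\<parallel> \<le> \<alpha> \<eta> L \<parallel>z - z_star\<parallel>\<close> for the next iterate \<open>z'\<close>,
  whereas nonexpansiveness of the projection gives the classical forward-step estimate
  \<open>\<parallel>p - z_star\<parallel>\<^sup>2 \<le> (1 - 2 \<eta> \<mu> + \<eta>\<^sup>2 L\<^sup>2) \<parallel>z - z_star\<parallel>\<^sup>2\<close>. The triangle inequality combines
  the two.\<close>

text \<open>From a relative interior point \<open>x\<close>, the segment from \<open>z\<close> to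
  \<open>x\<close> can be prolonged slightly beyond \<open>x\<close> inside \<open>Z\<close>. The
  variational inequality at the prolonged point carries the negative factor \<open>1 - e\<close>,
  which gives the reverse inequality.\<close>

lemma vi_solution_rel_interior_orthogonal:
  fixes Z :: "'a::euclidean_space set"
  assumes "convex Z" "x \<in> rel_interior Z" "vi_solution F Z x" "z \<in> Z"
  shows "F x \<bullet> (z - x) = 0"
proof -
  obtain e where e: "e > 1" "(1 - e) *\<^sub>R z + e *\<^sub>R x \<in> Z"
    using assms convex_rel_interior_iff[of Z x] by blast
  have "F x \<bullet> ((1 - e) *\<^sub>R z + e *\<^sub>R x - x) \<ge> 0"
    using assms(3) e(2) by (simp add: vi_solution_def)
  also have "(1 - e) *\<^sub>R z + e *\<^sub>R x - x = (1 - e) *\<^sub>R (z - x)"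
    by (simp add: algebra_simps)
  finally have "(1 - e) * (F x \<bullet> (z - x)) \<ge> 0"
    by simp
  moreover have "F x \<bullet> (z - x) \<ge> 0"
    using assms(3,4) by (simp add: vi_solution_def)
  ultimately show ?thesis
    using e(1) by (simp add: zero_le_mult_iff)
qed

text \<open>The projection onto the closure need not be a value of \<open>g\<close>. It is a limit
  of such values, and the bound passes to the limit by continuity of the norm.\<close>

lemma INF_surrogate_loss_le:
  fixes g :: "'p \<Rightarrow> 'a::real_inner"
  assumes "p \<in> closure (range g)"
  shows "(INF \<theta>. surrogate_loss g F \<eta> \<theta>t \<theta>)
    \<le> 1 / 2 * (norm (p - (g \<theta>t - \<eta> *\<^sub>R F (g \<theta>t))))\<^sup>2"
proof -
  obtain x where x: "\<And>n. x n \<in> range g" "x \<longlonglongrightarrow> p"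
    using assms unfolding closure_sequential by blast
  have "bdd_below (range (surrogate_loss g F \<eta> \<theta>t))"
    by (rule bdd_belowI[where m = 0]) (auto simp: surrogate_loss_def)
  then have "(INF \<theta>. surrogate_loss g F \<eta> \<theta>t \<theta>) \<le> surrogate_loss g F \<eta> \<theta>t \<theta>" for \<theta>
    by (rule cINF_lower) simp
  then have "(INF \<theta>. surrogate_loss g F \<eta> \<theta>t \<theta>)
      \<le> 1 / 2 * (norm (x n - (g \<theta>t - \<eta> *\<^sub>R F (g \<theta>t))))\<^sup>2" for n
    using x(1)[of n] unfolding surrogate_loss_def by (metis imageE)
  moreover have "(\<lambda>n. 1 / 2 * (norm (x n - (g \<theta>t - \<eta> *\<^sub>R F (g \<theta>t))))\<^sup>2)
      \<longlonglongrightarrow> 1 / 2 * (norm (p - (g \<theta>t - \<eta> *\<^sub>R F (g \<theta>t))))\<^sup>2"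
    by (intro tendsto_intros x(2))
  ultimately show ?thesis
    by (intro LIMSEQ_le_const) auto
qed

text \<open>The returned parameter violates the loop guard. Collecting the infimum on one side
  leaves it with the coefficient \<open>1 - \<alpha>\<^sup>2\<close>, which is positive, so it may
  be replaced by the larger value at \<open>p\<close>.\<close>

lemma surrogate_descent_step_decrease:
  fixes g :: "'p \<Rightarrow> 'a::real_inner"
  assumes step: "surrogate_descent_step g F \<eta> \<alpha> \<A> \<theta>t = Some \<theta>'"
    and p: "p \<in> closure (range g)"
    and \<alpha>: "0 < \<alpha>" "\<alpha> < 1"
    and w: "w = g \<theta>t - \<eta> *\<^sub>R F (g \<theta>t)"
  shows "(norm (g \<theta>' - w))\<^sup>2 - (norm (p - w))\<^sup>2
    \<le> \<alpha>\<^sup>2 * ((norm (g \<theta>t - w))\<^sup>2 - (norm (p - w))\<^sup>2)"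
proof -
  define l where "l = surrogate_loss g F \<eta> \<theta>t"
  define l_inf where "l_inf = (INF \<theta>. l \<theta>)"
  have l: "l \<theta> = 1 / 2 * (norm (g \<theta> - w))\<^sup>2" for \<theta>
    by (simp add: l_def surrogate_loss_def w)
  have "l \<theta>' - l_inf \<le> \<alpha>\<^sup>2 * (l \<theta>t - l_inf)"
    using step while_option_stop
    unfolding surrogate_descent_step_def Let_def l_def l_inf_def by fastforce
  moreover have "(1 - \<alpha>\<^sup>2) * l_inf \<le> (1 - \<alpha>\<^sup>2) * (1 / 2 * (norm (p - w))\<^sup>2)"
    using INF_surrogate_loss_le[OF p, of F \<eta> \<theta>t] \<alpha>
    by (intro mult_left_mono) (simp_all add: l_inf_def l_def w power_le_one)
  ultimately show ?thesis
    unfolding l by (simp add: algebra_simps)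
qed

lemma inexact_projected_step_contraction:
  fixes Z :: "'a::euclidean_space set"
  assumes Z: "convex Z" "closed Z"
    and lip: "L-lipschitz_on Z F"
    and mono: "strongly_monotone_on \<mu> Z F"
    and ri: "s \<in> rel_interior Z" and vi: "vi_solution F Z s"
    and pos: "0 < \<alpha>" "0 < \<eta>"
    and in_Z: "x \<in> Z" "y \<in> Z"
    and decrease: "\<And>p. p \<in> Z \<Longrightarrow>
      (norm (y - (x - \<eta> *\<^sub>R F x)))\<^sup>2 - (norm (p - (x - \<eta> *\<^sub>R F x)))\<^sup>2
      \<le> \<alpha>\<^sup>2 * ((norm (x - (x - \<eta> *\<^sub>R F x)))\<^sup>2 - (norm (p - (x - \<eta> *\<^sub>R F x)))\<^sup>2)"
    and \<rho>: "\<rho> = 1 - 2 * \<eta> * (\<mu> - \<alpha> * L) + (1 + \<alpha>\<^sup>2) * \<eta>\<^sup>2 * L\<^sup>2" "\<rho> < 1"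
  shows "(norm (y - s))\<^sup>2 \<le> \<rho> * (norm (x - s))\<^sup>2"
proof -
  define w where "w = x - \<eta> *\<^sub>R (F x - F s)"
  define p where "p = closest_point Z w"
  define D where "D = norm (x - s)"
  have s: "s \<in> Z" and L: "L \<ge> 0"
    using vi lip by (simp_all add: vi_solution_def lipschitz_on_def)
  have p: "p \<in> Z"
    unfolding p_def using Z(2) s by (intro closest_point_in_set) auto
  have D: "D \<ge> 0" by (simp add: D_def)
  have F_le: "norm (F x - F s) \<le> L * D"
    using lipschitz_onD[OF lip in_Z(1) s] by (simp add: dist_norm D_def)
  then have F_le2: "(norm (F x - F s))\<^sup>2 \<le> L\<^sup>2 * D\<^sup>2"
    by (metis norm_ge_zero power_mono power_mult_distrib)

  \<comment> \<open>The added term does not depend on \<open>u\<close>, so it cancels in both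
    differences of \<open>decrease\<close>.\<close>
  have shift: "(norm (u - (x - \<eta> *\<^sub>R F x)))\<^sup>2
      = (norm (u - w))\<^sup>2 + (2 * \<eta> * (F s \<bullet> (s - w)) + \<eta>\<^sup>2 * (norm (F s))\<^sup>2)"
    if "u \<in> Z" for u
  proof -
    have "F s \<bullet> (u - s) = 0"
      using vi_solution_rel_interior_orthogonal[OF Z(1) ri vi that] .
    then have "F s \<bullet> (u - w) = F s \<bullet> (s - w)"
      by (simp add: inner_diff_right)
    moreover have u: "u - (x - \<eta> *\<^sub>R F x) = (u - w) + \<eta> *\<^sub>R F s"
      by (simp add: w_def algebra_simps)
    ultimately show ?thesis
      unfolding u using dot_norm[of "u - w" "\<eta> *\<^sub>R F s"]
      by (simp add: inner_commute[of "u - w" "F s"] field_simps)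
  qed
  have "(norm (y - p))\<^sup>2 \<le> (norm (y - w))\<^sup>2 - (norm (p - w))\<^sup>2"
  proof -
    have "(w - p) \<bullet> (y - p) \<le> 0"
      unfolding p_def using closest_point_dot[OF Z in_Z(2)] .
    moreover have "(norm (y - w))\<^sup>2 = (norm (y - p))\<^sup>2 + (norm (p - w))\<^sup>2 - 2 * ((w - p) \<bullet> (y - p))"
      by (simp add: power2_norm_eq_inner inner_diff_left inner_diff_right inner_commute)
    ultimately show ?thesis by linarith
  qed
  also have "\<dots> \<le> \<alpha>\<^sup>2 * ((norm (x - w))\<^sup>2 - (norm (p - w))\<^sup>2)"
    using decrease[OF p] unfolding shift[OF p] shift[OF in_Z(1)] shift[OF in_Z(2)] by simp
  also have "\<dots> \<le> \<alpha>\<^sup>2 * (norm (x - w))\<^sup>2"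
    by (intro mult_left_mono) auto
  also have "\<dots> = (\<alpha> * \<eta>)\<^sup>2 * (norm (F x - F s))\<^sup>2"
    by (simp add: w_def power_mult_distrib)
  also have "\<dots> \<le> (\<alpha> * \<eta>)\<^sup>2 * (L\<^sup>2 * D\<^sup>2)"
    using F_le2 by (intro mult_left_mono) auto
  finally have "(norm (y - p))\<^sup>2 \<le> (\<alpha> * \<eta> * L * D)\<^sup>2"
    by (simp add: power_mult_distrib mult_ac)
  then have yp: "norm (y - p) \<le> \<alpha> * \<eta> * L * D"
    by (rule power2_le_imp_le) (use pos L D in simp)

  \<comment> \<open>Projections do not increase distances, and \<open>s\<close> is its own
    projection.\<close>
  have "dist (closest_point Z w) (closest_point Z s) \<le> dist w s"
    using Z s by (intro closest_point_lipschitz) auto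
  then have ps: "norm (p - s) \<le> norm (w - s)"
    using s by (simp add: p_def dist_norm closest_point_self)
  have "(norm (w - s))\<^sup>2
      = D\<^sup>2 - 2 * \<eta> * ((F x - F s) \<bullet> (x - s)) + \<eta>\<^sup>2 * (norm (F x - F s))\<^sup>2"
  proof -
    have "w - s = (x - s) - \<eta> *\<^sub>R (F x - F s)" by (simp add: w_def)
    then show ?thesis
      unfolding D_def power2_norm_eq_inner power2_eq_square[of \<eta>]
      by (simp only: inner_diff_left[of "x - s"] inner_diff_right[of _ "x - s"]
          inner_scaleR_left inner_scaleR_right inner_commute[of "x - s" "F x - F s"])
        (simp add: algebra_simps)
  qed
  also have "\<dots> \<le> D\<^sup>2 - 2 * \<eta> * (\<mu> * D\<^sup>2) + \<eta>\<^sup>2 * (L\<^sup>2 * D\<^sup>2)"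
    using mono in_Z s F_le2 pos unfolding strongly_monotone_on_def D_def
    by (intro add_mono diff_mono mult_left_mono) auto
  finally have ws: "(norm (w - s))\<^sup>2 \<le> (1 - 2 * \<eta> * \<mu> + \<eta>\<^sup>2 * L\<^sup>2) * D\<^sup>2"
    by (simp add: algebra_simps)
  \<comment> \<open>The rate exceeds the forward-step factor by nonnegative terms, so
    \<open>\<rho> < 1\<close> forces that factor to be at most 1. The resulting bound
    \<open>norm (w - s) \<le> D\<close> controls the cross term of the square below.\<close>
  have "1 - 2 * \<eta> * \<mu> + \<eta>\<^sup>2 * L\<^sup>2 + (2 * \<eta> * \<alpha> * L + (\<alpha> * \<eta> * L)\<^sup>2) = \<rho>"
    by (simp add: \<rho> algebra_simps power2_eq_square)
  moreover have "2 * \<eta> * \<alpha> * L + (\<alpha> * \<eta> * L)\<^sup>2 \<ge> 0"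
    using pos L by simp
  ultimately have "1 - 2 * \<eta> * \<mu> + \<eta>\<^sup>2 * L\<^sup>2 \<le> 1"
    using \<rho>(2) by linarith
  then have "(norm (w - s))\<^sup>2 \<le> 1 * D\<^sup>2"
    by (intro order_trans[OF ws] mult_right_mono) auto
  then have wD: "norm (w - s) \<le> D"
    using power2_le_imp_le[OF _ D] by simp

  have "norm (y - s) \<le> norm (w - s) + \<alpha> * \<eta> * L * D"
    using norm_triangle_ineq[of "y - p" "p - s"] yp ps by simp
  then have "(norm (y - s))\<^sup>2 \<le> (norm (w - s) + \<alpha> * \<eta> * L * D)\<^sup>2"
    by (intro power_mono) auto
  also have "\<dots> = (norm (w - s))\<^sup>2 + 2 * (\<alpha> * \<eta> * L * D) * norm (w - s) + (\<alpha> * \<eta> * L * D)\<^sup>2"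
    by (simp add: power2_sum)
  also have "\<dots> \<le> (1 - 2 * \<eta> * \<mu> + \<eta>\<^sup>2 * L\<^sup>2) * D\<^sup>2
      + 2 * (\<alpha> * \<eta> * L * D) * D + (\<alpha> * \<eta> * L * D)\<^sup>2"
    using ws wD pos L D by (intro add_mono mult_left_mono) auto
  also have "\<dots> = \<rho> * D\<^sup>2"
    by (simp add: \<rho> algebra_simps power2_eq_square)
  finally show ?thesis by (simp add: D_def)
qed

text \<open>Cauchy-Schwarz places the monotonicity bound below \<open>L\<close> times the squared
  distance, which is nonzero for two distinct points and cancels.\<close>

lemma strongly_monotone_le_lipschitz:
  assumes "L-lipschitz_on Z F" "strongly_monotone_on \<mu> Z F" "x \<in> Z" "y \<in> Z" "x \<noteq> y"
  shows "\<mu> \<le> L"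
proof -
  have "\<mu> * (norm (x - y))\<^sup>2 \<le> (F x - F y) \<bullet> (x - y)"
    using assms(2-4) by (simp add: strongly_monotone_on_def)
  also have "\<dots> \<le> norm (F x - F y) * norm (x - y)"
    by (rule norm_cauchy_schwarz)
  also have "\<dots> \<le> L * norm (x - y) * norm (x - y)"
    using lipschitz_onD[OF assms(1,3,4)] by (intro mult_right_mono) (simp_all add: dist_norm)
  finally show ?thesis
    using assms(5) by (simp add: power2_eq_square)
qed

text \<open>Iterating the one-step bound requires a nonnegative rate. Completing the square in
  \<open>\<eta> * L\<close> writes the rate as a sum of nonnegative terms, where
  \<open>\<mu> \<le> L\<close> handles the only term of doubtful sign.\<close>

lemma contraction_rate_nonneg:
  fixes \<alpha> \<eta> \<mu> L :: real
  assumes "0 < \<alpha>" "0 < \<eta>" "0 < \<mu>" "\<mu> \<le> L"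
  shows "0 \<le> 1 - 2 * \<eta> * (\<mu> - \<alpha> * L) + (1 + \<alpha>\<^sup>2) * \<eta>\<^sup>2 * L\<^sup>2"
proof -
  have "0 \<le> (1 - \<eta> * L)\<^sup>2 + 2 * \<eta> * (L - \<mu>) + 2 * \<eta> * \<alpha> * L + (\<alpha> * \<eta> * L)\<^sup>2"
    using assms by simp
  also have "\<dots> = 1 - 2 * \<eta> * (\<mu> - \<alpha> * L) + (1 + \<alpha>\<^sup>2) * \<eta>\<^sup>2 * L\<^sup>2"
    by (simp add: algebra_simps power2_eq_square)
  finally show ?thesis .
qed

theorem theorem3p2:
  fixes g :: "real ^ 'd \<Rightarrow> real ^ 'n"
    and F :: "real ^ 'n \<Rightarrow> real ^ 'n"
    and Z :: "(real ^ 'n) set"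
    and z_star :: "real ^ 'n"
    and \<A> :: "(real ^ 'd \<Rightarrow> real) \<Rightarrow> real ^ 'd \<Rightarrow> real ^ 'd"
    and \<theta> :: "nat \<Rightarrow> real ^ 'd"
    and z :: "nat \<Rightarrow> real ^ 'n"
    and L \<mu> \<alpha> \<eta> \<rho> :: real
  assumes "Z = closure (range g)"
    and "convex Z"
    and "L-lipschitz_on Z F"
    and "\<mu> > 0"
    and "strongly_monotone_on \<mu> Z F"
    and "z_star \<in> rel_interior Z"
    and "vi_solution F Z z_star"
    and "0 < \<alpha>" and "\<alpha> < 1"
    and "\<eta> > 0"
    and "surrogate_descent_iterates g F \<eta> \<alpha> \<A> \<theta>"
    and "\<And>t. z t = g (\<theta> t)"
    and "\<rho> = 1 - 2 * \<eta> * (\<mu> - \<alpha> * L) + (1 + \<alpha>\<^sup>2) * \<eta>\<^sup>2 * L\<^sup>2"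
  shows "(\<rho> < 1 \<longrightarrow>
            z \<longlonglongrightarrow> z_star \<and>
            (\<forall>t\<ge>1. (norm (z (t + 1) - z_star))\<^sup>2 \<le> \<rho> ^ t * (norm (z 1 - z_star))\<^sup>2)) \<and>
         (\<alpha> < \<mu> / L \<and> \<eta> < 2 * (\<mu> - \<alpha> * L) / ((1 + \<alpha>\<^sup>2) * L\<^sup>2) \<longrightarrow> \<rho> < 1) \<and>
         (\<alpha> \<le> \<mu> / (2 * L) \<and> \<eta> = 2 * \<mu> / (5 * L\<^sup>2) \<and> (Z \<noteq> {z_star} \<or> \<mu> \<le> L)
            \<longrightarrow> \<rho> \<le> 1 - \<mu>\<^sup>2 / (5 * L\<^sup>2))"
proof (intro conjI)
  have L: "L \<ge> 0"
    using assms(3) by (simp add: lipschitz_on_def)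
  have s: "z_star \<in> Z"
    using assms(7) by (simp add: vi_solution_def)
  have z_in: "z t \<in> Z" for t
    unfolding assms(1,12) by (rule subsetD[OF closure_subset rangeI])

  show "\<rho> < 1 \<longrightarrow> z \<longlonglongrightarrow> z_star \<and>
      (\<forall>t\<ge>1. (norm (z (t + 1) - z_star))\<^sup>2 \<le> \<rho> ^ t * (norm (z 1 - z_star))\<^sup>2)"
  proof
    assume \<rho>: "\<rho> < 1"
    show "z \<longlonglongrightarrow> z_star \<and>
      (\<forall>t\<ge>1. (norm (z (t + 1) - z_star))\<^sup>2 \<le> \<rho> ^ t * (norm (z 1 - z_star))\<^sup>2)"
    \<comment> \<open>For a singleton \<open>Z\<close> the rate \<open>\<rho>\<close> may be negative.\<close>
    proof (cases "Z = {z_star}")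
      case True
      then have "z = (\<lambda>_. z_star)"
        using z_in by auto
      then show ?thesis by simp
    next
      case False
      \<comment> \<open>A second point of \<open>Z\<close> forces
        \<open>\<mu> \<le> L\<close>.\<close>
      then have \<rho>0: "\<rho> \<ge> 0"
        using strongly_monotone_le_lipschitz[OF assms(3,5) _ s] s assms(4,8,10,13)
          contraction_rate_nonneg by blast
      have step: "(norm (z (Suc t) - z_star))\<^sup>2 \<le> \<rho> * (norm (z t - z_star))\<^sup>2" if "t \<ge> 1" for t
      proof (rule inexact_projected_step_contraction[OF assms(2) _ assms(3,5-8,10) z_in z_in _
            assms(13) \<rho>])
        show "closed Z"
          by (simp add: assms(1))
        show "(norm (z (Suc t) - (z t - \<eta> *\<^sub>R F (z t))))\<^sup>2 - (norm (p - (z t - \<eta> *\<^sub>R F (z t))))\<^sup>2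
          \<le> \<alpha>\<^sup>2 * ((norm (z t - (z t - \<eta> *\<^sub>R F (z t))))\<^sup>2 - (norm (p - (z t - \<eta> *\<^sub>R F (z t))))\<^sup>2)"
          if "p \<in> Z" for p
          unfolding assms(12)
        proof (rule surrogate_descent_step_decrease[where g = g, OF _ _ assms(8,9) refl])
          show "surrogate_descent_step g F \<eta> \<alpha> \<A> (\<theta> t) = Some (\<theta> (Suc t))"
            using assms(11) \<open>t \<ge> 1\<close> by (simp add: surrogate_descent_iterates_def)
          show "p \<in> closure (range g)"
            using that assms(1) by simp
        qed
      qed
      \<comment> \<open>The induction starts at \<open>t = 0\<close>, where both sides agree;
        \<open>step\<close> is only ever applied at indices \<open>Suc t\<close>, as it must
        be.\<close>
      have rate: "(norm (z (Suc t) - z_star))\<^sup>2 \<le> \<rho> ^ t * (norm (z 1 - z_star))\<^sup>2" for t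
      proof (induction t)
        case (Suc t)
        have "(norm (z (Suc (Suc t)) - z_star))\<^sup>2 \<le> \<rho> * (norm (z (Suc t) - z_star))\<^sup>2"
          by (rule step) simp
        also have "\<dots> \<le> \<rho> * (\<rho> ^ t * (norm (z 1 - z_star))\<^sup>2)"
          using Suc.IH \<rho>0 by (rule mult_left_mono)
        finally show ?case by (simp add: mult.assoc)
      qed simp
      have "(\<lambda>t. \<rho> ^ t * (norm (z 1 - z_star))\<^sup>2) \<longlonglongrightarrow> 0"
        using \<rho> \<rho>0 by (intro tendsto_mult_left_zero LIMSEQ_realpow_zero)
      then have "(\<lambda>t. (norm (z (Suc t) - z_star))\<^sup>2) \<longlonglongrightarrow> 0"
        by (rule Lim_null_comparison[rotated]) (use rate in simp)
      then have "(\<lambda>t. z (Suc t) - z_star) \<longlonglongrightarrow> 0"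
        by (simp add: tendsto_norm_zero_iff)
      then have "z \<longlonglongrightarrow> z_star"
        by (simp add: LIM_zero_iff filterlim_sequentially_Suc)
      then show ?thesis
        using rate by simp
    qed
  qed

  show "\<alpha> < \<mu> / L \<and> \<eta> < 2 * (\<mu> - \<alpha> * L) / ((1 + \<alpha>\<^sup>2) * L\<^sup>2) \<longrightarrow> \<rho> < 1"
  proof
    assume *: "\<alpha> < \<mu> / L \<and> \<eta> < 2 * (\<mu> - \<alpha> * L) / ((1 + \<alpha>\<^sup>2) * L\<^sup>2)"
    \<comment> \<open>For \<open>L = 0\<close> the quotient \<open>\<mu> / L\<close> is 0 by
      convention, contradicting \<open>\<alpha> > 0\<close>.\<close>
    then have "L > 0"
      using L assms(8) by (cases "L = 0") auto
    then have "(1 + \<alpha>\<^sup>2) * L\<^sup>2 > 0"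
      by (simp add: add_pos_nonneg)
    with * have "\<eta> * ((1 + \<alpha>\<^sup>2) * L\<^sup>2) < 2 * (\<mu> - \<alpha> * L)"
      by (simp add: pos_less_divide_eq)
    \<comment> \<open>The difference of the two sides is exactly \<open>\<rho> - 1\<close>.\<close>
    then have "\<eta> * (\<eta> * ((1 + \<alpha>\<^sup>2) * L\<^sup>2)) < \<eta> * (2 * (\<mu> - \<alpha> * L))"
      using assms(10) by (rule mult_strict_left_mono)
    then show "\<rho> < 1"
      unfolding assms(13) by (simp add: power2_eq_square mult_ac)
  qed

  show "\<alpha> \<le> \<mu> / (2 * L) \<and> \<eta> = 2 * \<mu> / (5 * L\<^sup>2) \<and> (Z \<noteq> {z_star} \<or> \<mu> \<le> L)
      \<longrightarrow> \<rho> \<le> 1 - \<mu>\<^sup>2 / (5 * L\<^sup>2)"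
  proof
    assume *: "\<alpha> \<le> \<mu> / (2 * L) \<and> \<eta> = 2 * \<mu> / (5 * L\<^sup>2) \<and> (Z \<noteq> {z_star} \<or> \<mu> \<le> L)"
    \<comment> \<open>Again \<open>L = 0\<close> would make the bound on \<alpha> equal to
      0.\<close>
    then have "L > 0"
      using L assms(8) by (cases "L = 0") auto
    \<comment> \<open>On a singleton the two constants are unrelated, so there the second
      alternative supplies the inequality.\<close>
    have "\<mu> \<le> L"
      using * strongly_monotone_le_lipschitz[OF assms(3,5) _ s] s by blast
    have \<alpha>L: "2 * (\<alpha> * L) \<le> \<mu>"
      using * \<open>L > 0\<close> by (simp add: field_simps)
    also note \<open>\<mu> \<le> L\<close>
    finally have "\<alpha> \<le> 1 / 2"
      using \<open>L > 0\<close> by simp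
    then have \<alpha>2: "\<alpha>\<^sup>2 \<le> (1 / 2)\<^sup>2"
      using assms(8) by (intro power_mono) auto
    \<comment> \<open>This turns every term of \<open>\<rho> - 1\<close> into a multiple of
      \<open>\<eta>\<close>, to be compared with \<open>\<eta> * \<mu>\<close>.\<close>
    have \<eta>L: "\<eta> * L\<^sup>2 = 2 * \<mu> / 5"
      using * \<open>L > 0\<close> by simp
    have "\<eta> * (2 * (\<alpha> * L)) \<le> \<eta> * \<mu>"
      using \<alpha>L assms(10) by (intro mult_left_mono) auto
    moreover have "(1 + \<alpha>\<^sup>2) * (\<eta> * (2 * \<mu> / 5)) \<le> (1 + (1 / 2)\<^sup>2) * (\<eta> * (2 * \<mu> / 5))"
      using \<alpha>2 assms(4,10) by (intro mult_right_mono) auto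
    moreover have "\<rho> = 1 - 2 * \<eta> * \<mu> + \<eta> * (2 * (\<alpha> * L)) + (1 + \<alpha>\<^sup>2) * (\<eta> * (2 * \<mu> / 5))"
      unfolding assms(13) \<eta>L[symmetric] by (simp add: algebra_simps power2_eq_square)
    \<comment> \<open>In units of \<open>\<eta> * \<mu>\<close> the terms add up to at most -2 + 1 +
      (5/4) * (2/5) = -1/2.\<close>
    ultimately have "\<rho> \<le> 1 - \<eta> * \<mu> / 2"
      by (simp add: power2_eq_square)
    also have "\<dots> = 1 - \<mu>\<^sup>2 / (5 * L\<^sup>2)"
      using * by (simp add: power2_eq_square)
    finally show "\<rho> \<le> 1 - \<mu>\<^sup>2 / (5 * L\<^sup>2)" .
  qed
qed

end
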